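(* Let $d\in\mathbb{N}$, let $\Omega\subset\mathbb{C}^d$ be a nonempty open set, and let $\mathcal{X}\subset\operatorname{Hol}(\Omega)$ be a Hausdorff topological vector space satisfying properties P1, P2, P3 (see context). Let $\mathcal{F}\subset\mathcal{P}_d$ be a family of polynomials such that $V(\mathfrak{I}_{\mathcal{F}})$ is finite, where $\mathfrak{I}_{\mathcal{F}}$ is the ideal of $\mathcal{P}_d$ defined by $I(\mathcal{F})=\mathfrak{g}(\mathcal{F})\,\mathfrak{I}_{\mathcal{F}}$. Then $\mathcal{F}$ is jointly cyclic if and only if $V(\mathcal{F})\cap\Omega_{max}=\emptyset$ and $\mathfrak{g}(\mathcal{F})$ is cyclic.
   Context: All vector spaces are over $\mathbb{C}$; topological vector spaces are not assumed locally convex. $\operatorname{Hol}(\Omega)$ is the space of holomorphic functions on $\Omega$. $\mathcal{P}_d$ is the ring of polynomials in $d$ complex variables over $\mathbb{C}$, whose elements are also viewed (by restriction) as functions on $\Omega$. The properties are: P1: $\mathcal{P}_d\subset\mathcal{X}$ and $\mathcal{P}_d$ is dense in $\mathcal{X}$. P2: for each $w\in\Omega$ the evaluation functional $\Lambda_w(F)=F(w)$, $F\in\mathcal{X}$, is continuous. P3: for each $1\le j\le d$ the shift operator $S_jF(z)=z_jF(z)$ maps $\mathcal{X}$ to $\mathcal{X}$ and is continuous. For $F\in\mathcal{X}$, $S[F]:=\overline{\{PF:P\in\mathcal{P}_d\}}$ (closure in $\mathcal{X}$); $F$ is cyclic if $S[F]=\mathcal{X}$. For a family $\mathcal{F}\subset\mathcal{X}$,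 $S[\mathcal{F}]$ is the closed linear span in $\mathcal{X}$ of $\bigcup_{F\in\mathcal{F}}S[F]$; $\mathcal{F}$ is jointly cyclic if $S[\mathcal{F}]=\mathcal{X}$. For $\mathcal{F}\subset\mathcal{P}_d$: $V(\mathcal{F}):=\{w\in\mathbb{C}^d:P(w)=0\text{ for all }P\in\mathcal{F}\}$; $I(\mathcal{F})$ is the ideal of $\mathcal{P}_d$ generated by $\mathcal{F}$; $\mathfrak{g}(\mathcal{F})$ is the greatest common divisor of $\mathcal{F}$ in the unique factorization domain $\mathcal{P}_d$ (defined up to a nonzero constant); and $\mathfrak{I}_{\mathcal{F}}$ is the ideal of $\mathcal{P}_d$ with $I(\mathcal{F})=\mathfrak{g}(\mathcal{F})\,\mathfrak{I}_{\mathcal{F}}$, i.e. $\mathfrak{I}_{\mathcal{F}}=\{Q\in\mathcal{P}_d: \mathfrak{g}(\mathcal{F})Q\in I(\mathcal{F})\}$ (for a family with no nonzero element, $\mathfrak{g}(\mathcal{F})=0$ and $\mathfrak{I}_{\mathcal{F}}=\mathcal{P}_d$). Maximal domain: $\Omega_{max}$ is the set of all $w\in\mathbb{C}^d$ such that the functional $P\mapsto P(w)$ on $\mathcal{P}_d$ extends to a continuous linear functional on $\mathcal{X}$. *)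

theory Defs
  imports "HOL-Analysis.Analysis" "HOL-Library.Poly_Mapping" "HOL-Library.Function_Algebras"
begin

text \<open>
  The ring of polynomials in \<open>d = CARD('n)\<close> variables is the monoid algebra of finitely
  supported maps from exponent vectors to coefficients.
\<close>

type_synonym 'n cpoly = "('n \<Rightarrow>\<^sub>0 nat) \<Rightarrow>\<^sub>0 complex"

type_synonym 'n cfun = "complex ^ 'n \<Rightarrow> complex"

definition cpoly_eval :: "'n::finite cpoly \<Rightarrow> complex ^ 'n \<Rightarrow> complex" where
  "cpoly_eval P z =
     (\<Sum>m\<in>Poly_Mapping.keys P. Poly_Mapping.lookup P m * (\<Prod>j\<in>UNIV. (z $ j) ^ Poly_Mapping.lookup m j))"

interpretation cring: module "(*) :: 'a::comm_ring_1 \<Rightarrow> 'a \<Rightarrow> 'a"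
  by (rule module.intro) (rule distrib_left distrib_right mult.assoc[symmetric] mult_1_left)+

interpretation cfun: vector_space "\<lambda>(c::complex) (f::'a \<Rightarrow> complex) z. c * f z"
  by (rule vector_space.intro) (simp_all add: fun_eq_iff distrib_left distrib_right)

text \<open>
  A commutative ring is a module over itself; its submodules are the ideals, and the span of a
  set is the ideal generated by it.
\<close>

definition ideal_gen :: "'n::finite cpoly set \<Rightarrow> 'n cpoly set" where
  "ideal_gen \<F> = cring.span \<F>"

definition zero_set :: "'n::finite cpoly set \<Rightarrow> (complex ^ 'n) set" where
  "zero_set \<F> = {w. \<forall>P\<in>\<F>. cpoly_eval P w = 0}"

text \<open>
  Greatest common divisors are unique only up to a unit, hence a relation. If the family has no
  nonzero element, its only greatest common divisor is \<open>0\<close>.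
\<close>

definition is_gcd_of :: "'n::finite cpoly \<Rightarrow> 'n cpoly set \<Rightarrow> bool" where
  "is_gcd_of g \<F> \<longleftrightarrow> (\<forall>P\<in>\<F>. g dvd P) \<and> (\<forall>h. (\<forall>P\<in>\<F>. h dvd P) \<longrightarrow> h dvd g)"

definition quotient_ideal :: "'n::finite cpoly \<Rightarrow> 'n cpoly set \<Rightarrow> 'n cpoly set" where
  "quotient_ideal g \<F> = {Q. g * Q \<in> ideal_gen \<F>}"

text \<open>
  A function on \<open>\<Omega>\<close> is encoded as the total function extending it by \<open>0\<close> outside \<open>\<Omega>\<close>, so that
  equality of functions on \<open>\<Omega>\<close> is equality and the vector space operations are pointwise.
  Holomorphy is Frechet differentiability with complex linear derivative.
\<close>

definition Hol :: "(complex ^ 'n::finite) set \<Rightarrow> 'n cfun set" where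
  "Hol \<Omega> = {f. (\<forall>z. z \<notin> \<Omega> \<longrightarrow> f z = 0) \<and>
     (\<forall>z\<in>\<Omega>. \<exists>L. (f has_derivative L) (at z) \<and> (\<forall>c v. L (c *s v) = c * L v))}"

definition poly_on :: "(complex ^ 'n::finite) set \<Rightarrow> 'n cpoly \<Rightarrow> 'n cfun" where
  "poly_on \<Omega> P = (\<lambda>z. if z \<in> \<Omega> then cpoly_eval P z else 0)"

text \<open>
  The space is its topology: the underlying set is \<^term>\<open>topspace X\<close>, and no local convexity is
  required.
\<close>

definition hausdorff_tvs_in_Hol :: "(complex ^ 'n::finite) set \<Rightarrow> 'n cfun topology \<Rightarrow> bool" where
  "hausdorff_tvs_in_Hol \<Omega> X \<longleftrightarrow>
     topspace X \<subseteq> Hol \<Omega> \<and>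
     cfun.subspace (topspace X) \<and>
     Hausdorff_space X \<and>
     continuous_map (prod_topology X X) X (\<lambda>(F, G). F + G) \<and>
     continuous_map (prod_topology euclidean X) X (\<lambda>(c, F). (\<lambda>z. c * F z))"

definition P1 :: "(complex ^ 'n::finite) set \<Rightarrow> 'n cfun topology \<Rightarrow> bool" where
  "P1 \<Omega> X \<longleftrightarrow> range (poly_on \<Omega>) \<subseteq> topspace X \<and> X closure_of range (poly_on \<Omega>) = topspace X"

definition P2 :: "(complex ^ 'n::finite) set \<Rightarrow> 'n cfun topology \<Rightarrow> bool" where
  "P2 \<Omega> X \<longleftrightarrow> (\<forall>w\<in>\<Omega>. continuous_map X euclidean (\<lambda>F. F w))"

definition P3 :: "'n::finite cfun topology \<Rightarrow> bool" where
  "P3 X \<longleftrightarrow> (\<forall>j. continuous_map X X (\<lambda>F z. z $ j * F z))"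

definition invariant_closure :: "'n::finite cfun topology \<Rightarrow> 'n cfun \<Rightarrow> 'n cfun set" where
  "invariant_closure X F = X closure_of (range (\<lambda>P z. cpoly_eval P z * F z))"

definition cyclic :: "'n::finite cfun topology \<Rightarrow> 'n cfun \<Rightarrow> bool" where
  "cyclic X F \<longleftrightarrow> invariant_closure X F = topspace X"

definition joint_invariant_closure :: "'n::finite cfun topology \<Rightarrow> 'n cfun set \<Rightarrow> 'n cfun set" where
  "joint_invariant_closure X \<F> = X closure_of cfun.span (\<Union>F\<in>\<F>. invariant_closure X F)"

definition jointly_cyclic :: "'n::finite cfun topology \<Rightarrow> 'n cfun set \<Rightarrow> bool" where
  "jointly_cyclic X \<F> \<longleftrightarrow> joint_invariant_closure X \<F> = topspace X"

definition continuous_linear_functional ::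
    "'n::finite cfun topology \<Rightarrow> ('n cfun \<Rightarrow> complex) \<Rightarrow> bool" where
  "continuous_linear_functional X \<phi> \<longleftrightarrow>
     continuous_map X euclidean \<phi> \<and>
     (\<forall>F\<in>topspace X. \<forall>G\<in>topspace X. \<phi> (F + G) = \<phi> F + \<phi> G) \<and>
     (\<forall>c. \<forall>F\<in>topspace X. \<phi> (\<lambda>z. c * F z) = c * \<phi> F)"

definition max_domain :: "(complex ^ 'n::finite) set \<Rightarrow> 'n cfun topology \<Rightarrow> (complex ^ 'n) set" where
  "max_domain \<Omega> X =
     {w. \<exists>\<phi>. continuous_linear_functional X \<phi> \<and> (\<forall>P. \<phi> (poly_on \<Omega> P) = cpoly_eval P w)}"

end

theory Submission
  imports Defs "HOL-Computational_Algebra.Fundamental_Theorem_Algebra"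
begin

text \<open>
  Call a polynomial ideal dense if its closure in \<open>X\<close> contains \<open>1\<close>, hence is all of \<open>X\<close>.
  Joint cyclicity means that the ideal \<open>I\<close> generated by the family is dense. Let \<open>J\<close> be the
  quotient ideal, so that \<open>I = g J\<close>. Since multiplication by \<open>g\<close> is continuous, \<open>I\<close> is dense iff
  both \<open>J\<close> and \<open>(g)\<close> are. A dense ideal has no zeros in the maximal domain; as
  \<open>V(I) = V(J) \<union> V(g)\<close>, it remains to see that \<open>J\<close> is dense if \<open>V(J)\<close> misses the maximal domain.

  If \<open>J\<close> is not dense, one point \<open>w\<close> of \<open>V(J)\<close> lies in the maximal domain. Since \<open>V(J)\<close> is finite,
  \<open>J\<close> contains for each \<open>j\<close> a product of factors \<open>z\<^sub>j - c\<close>. If a non-dense ideal contains a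
  product, then some factor can be adjoined to it so that the ideal stays non-dense; after all
  variables are treated, the maximal ideal of some \<open>w \<in> V(J)\<close> is non-dense. Its closure \<open>N\<close> is a
  closed subspace, so \<open>N + \<complex> 1\<close> is closed as well and therefore all of \<open>X\<close>. The linear functional
  with kernel \<open>N\<close> and value \<open>1\<close> at \<open>1\<close> is continuous because its kernel is closed, and it extends
  evaluation at \<open>w\<close>.

  The same adjunction, without any topology, proves the Nullstellensatz. There the product of linear
  factors comes from the uncountability of \<open>\<complex>\<close>: if \<open>z\<^sub>j - c\<close> is invertible modulo \<open>J\<close> for
  uncountably many \<open>c\<close>, the inverses are linearly dependent, and clearing denominators puts a nonzero
  polynomial in \<open>z\<^sub>j\<close> into \<open>J\<close>.
\<close>

subsection \<open>Vector spaces\<close>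

context vector_space
begin

lemma ex_finite_subset_span:
  assumes "x \<in> span B"
  shows "\<exists>T. finite T \<and> T \<subseteq> B \<and> x \<in> span T"
proof -
  obtain T r where T: "finite T" "T \<subseteq> B" "x = (\<Sum>b\<in>T. scale (r b) b)"
    using assms unfolding span_explicit by blast
  have "x \<in> span T"
    unfolding T(3) by (intro span_sum span_scale span_base)
  with T(1,2) show ?thesis by blast
qed

lemma countable_independent:
  assumes "countable B" "independent S" "S \<subseteq> span B"
  shows "countable S"
proof (rule countable_subset)
  show "S \<subseteq> (\<Union>T\<in>{T. finite T \<and> T \<subseteq> B}. S \<inter> span T)"
  proof
    fix x assume "x \<in> S"
    then show "x \<in> (\<Union>T\<in>{T. finite T \<and> T \<subseteq> B}. S \<inter> span T)"
      using ex_finite_subset_span[of x B] assms(3) by blast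
  qed
  have "finite (S \<inter> span T)" if "finite T" for T
    using independent_span_bound[OF that independent_mono[OF assms(2)], of "S \<inter> span T"] by blast
  then show "countable (\<Union>T\<in>{T. finite T \<and> T \<subseteq> B}. S \<inter> span T)"
    by (intro countable_UN[OF countable_Collect_finite_subset[OF assms(1)]] countable_finite) blast
qed

lemma ex_linear_relation_of_uncountable:
  assumes "countable B" "uncountable \<Lambda>" "f ` \<Lambda> \<subseteq> span B"
  shows "\<exists>T u. finite T \<and> T \<subseteq> \<Lambda> \<and> (\<exists>i\<in>T. u i \<noteq> 0) \<and> (\<Sum>i\<in>T. scale (u i) (f i)) = 0"
proof (cases "inj_on f \<Lambda>")
  case True
  then have "uncountable (f ` \<Lambda>)"
    using assms(2) by (simp add: countable_image_inj_eq)
  then have "dependent (f ` \<Lambda>)"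
    using countable_independent[OF assms(1) _ assms(3)] by blast
  then obtain t r where t: "finite t" "t \<subseteq> f ` \<Lambda>" "(\<Sum>v\<in>t. scale (r v) v) = 0" "\<exists>v\<in>t. r v \<noteq> 0"
    unfolding dependent_explicit by blast
  obtain T where T: "T \<subseteq> \<Lambda>" "inj_on f T" "t = f ` T"
    using t(2) unfolding subset_image_inj by blast
  show ?thesis
  proof (intro exI conjI)
    show "finite T" using t(1) T(2,3) by (simp add: finite_image_iff)
    show "T \<subseteq> \<Lambda>" by (rule T(1))
    show "\<exists>i\<in>T. r (f i) \<noteq> 0" using t(4) unfolding T(3) by blast
    show "(\<Sum>i\<in>T. scale (r (f i)) (f i)) = 0" using t(3) T(2,3) by (simp add: sum.reindex)
  qed
next
  case False
  then obtain a b where ab: "a \<in> \<Lambda>" "b \<in> \<Lambda>" "a \<noteq> b" "f a = f b"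
    unfolding inj_on_def by blast
  let ?u = "\<lambda>i. if i = a then 1 else - 1"
  have "(\<Sum>i\<in>{a, b}. scale (?u i) (f i)) = 0"
    using ab(3,4) by simp
  with ab(1,2) show ?thesis
    by (intro exI[of _ "{a, b}"] exI[of _ ?u]) simp
qed

lemma ex_linear_functional:
  assumes N: "subspace N" and e: "e \<notin> N"
  shows "\<exists>\<phi>. Vector_Spaces.linear scale (*) \<phi> \<and> (\<forall>x\<in>N. \<phi> x = 0) \<and> \<phi> e = 1"
proof -
  interpret vector_space_pair scale "(*) :: 'a \<Rightarrow> 'a \<Rightarrow> 'a"
    by unfold_locales (simp_all add: algebra_simps)
  obtain B where B: "B \<subseteq> N" "independent B" "N \<subseteq> span B"
    using maximal_independent_subset .
  have "span B \<subseteq> N"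
    using B(1) N by (rule span_minimal)
  with e have "e \<notin> span B" by blast
  then obtain \<phi> where \<phi>: "Vector_Spaces.linear scale (*) \<phi>"
      "\<And>b. b \<in> insert e B \<Longrightarrow> \<phi> b = (if b = e then 1 else 0)"
    using linear_independent_extend[OF independent_insertI[OF _ B(2)],
        of e "\<lambda>b. if b = e then 1 else 0"] by blast
  have "\<phi> x = 0" if "x \<in> N" for x
  proof (rule linear_eq_0_on_span[OF \<phi>(1)])
    show "x \<in> span B" using that B(3) by blast
    show "\<phi> b = 0" if "b \<in> B" for b
    proof -
      have "b \<noteq> e" using that B(1) e by blast
      then show ?thesis using \<phi>(2)[of b] that by simp
    qed
  qed
  moreover have "\<phi> e = 1" using \<phi>(2) by simp
  ultimately show ?thesis using \<phi>(1) by blast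
qed

end

subsection \<open>Topological vector spaces\<close>

lemma closedin_Bex_compact:
  fixes h :: "'c::topological_space \<Rightarrow> 'a \<Rightarrow> 'b"
  assumes "compact K" "closedin Y N"
    and h: "continuous_map (prod_topology (top_of_set K) X) Y (\<lambda>x. h (fst x) (snd x))"
  shows "closedin X {x \<in> topspace X. \<exists>c\<in>K. h c x \<in> N}"
proof -
  let ?Z = "prod_topology (top_of_set K) X"
  have "closedin ?Z {x \<in> topspace ?Z. h (fst x) (snd x) \<in> N}"
    using h assms(2) by (rule closedin_continuous_map_preimage)
  moreover have "closed_map ?Z X snd"
    using assms(1) by (intro Abstract_Topological_Spaces.closed_map_snd)
      (simp add: compact_space_subtopology)
  ultimately have "closedin X (snd ` {x \<in> topspace ?Z. h (fst x) (snd x) \<in> N})"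
    unfolding closed_map_def by blast
  also have "snd ` {x \<in> topspace ?Z. h (fst x) (snd x) \<in> N} = {x \<in> topspace X. \<exists>c\<in>K. h c x \<in> N}"
    by force
  finally show ?thesis .
qed

locale topological_vector_space = vector_space scale
  for scale :: "'k::{real_normed_field,heine_borel} \<Rightarrow> 'b::ab_group_add \<Rightarrow> 'b" (infixr \<open>*\<^sub>k\<close> 75) +
  fixes X :: "'b topology"
  assumes subspace_topspace: "subspace (topspace X)"
    and continuous_plus: "continuous_map (prod_topology X X) X (\<lambda>(x, y). x + y)"
    and continuous_times: "continuous_map (prod_topology euclidean X) X (\<lambda>(c, x). c *\<^sub>k x)"
begin

lemma continuous_map_add:
  assumes "continuous_map Z X f" "continuous_map Z X g"
  shows "continuous_map Z X (\<lambda>x. f x + g x)"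
  using continuous_map_compose[OF continuous_map_pairedI[OF assms] continuous_plus]
  by (simp add: o_def)

lemma continuous_map_scale:
  assumes "continuous_map Z euclidean c" "continuous_map Z X f"
  shows "continuous_map Z X (\<lambda>x. c x *\<^sub>k f x)"
  using continuous_map_compose[OF continuous_map_pairedI[OF assms] continuous_times]
  by (simp add: o_def)

lemma continuous_map_diff:
  assumes "continuous_map Z X f" "continuous_map Z X g"
  shows "continuous_map Z X (\<lambda>x. f x - g x)"
  using continuous_map_add[OF assms(1) continuous_map_scale[OF _ assms(2), of "\<lambda>_. - 1"]] by simp

lemma subspace_closure_of:
  assumes S: "subspace S"
  shows "subspace (X closure_of S)"
  unfolding subspace_def
proof (intro conjI ballI allI)
  show "0 \<in> X closure_of S"
    using closure_of_subset_Int[of X S] subspace_0[OF S] subspace_0[OF subspace_topspace] by blast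
next
  fix x y assume "x \<in> X closure_of S" "y \<in> X closure_of S"
  then have "x + y \<in> X closure_of ((\<lambda>(x, y). x + y) ` (S \<times> S))"
    using continuous_map_image_closure_subset[OF continuous_plus, of "S \<times> S"]
    by (auto simp: closure_of_Times)
  also have "(\<lambda>(x, y). x + y) ` (S \<times> S) \<subseteq> S"
    using subspace_add[OF S] by auto
  then have "X closure_of ((\<lambda>(x, y). x + y) ` (S \<times> S)) \<subseteq> X closure_of S"
    by (rule closure_of_mono)
  finally show "x + y \<in> X closure_of S" .
next
  fix c x assume "x \<in> X closure_of S"
  moreover have "continuous_map X X ((*\<^sub>k) c)"
    using continuous_map_scale[of X "\<lambda>_. c" "\<lambda>x. x"] by simp
  ultimately have "c *\<^sub>k x \<in> X closure_of ((*\<^sub>k) c ` S)"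
    using continuous_map_image_closure_subset by blast
  also have "(*\<^sub>k) c ` S \<subseteq> S"
    using subspace_scale[OF S] by auto
  then have "X closure_of ((*\<^sub>k) c ` S) \<subseteq> X closure_of S"
    by (rule closure_of_mono)
  finally show "c *\<^sub>k x \<in> X closure_of S" .
qed

lemma openin_absorbing:
  assumes V: "openin X V" "0 \<in> V" and x: "x \<in> topspace X"
  shows "\<exists>t. t \<noteq> 0 \<and> t *\<^sub>k x \<in> V"
proof -
  have "continuous_map euclidean X (\<lambda>t. t *\<^sub>k x)"
    using x by (intro continuous_map_scale) auto
  then have "open {t. t *\<^sub>k x \<in> V}"
    using openin_continuous_map_preimage[OF _ V(1)] by fastforce
  moreover have "0 \<in> {t. t *\<^sub>k x \<in> V}" using V(2) by simp
  ultimately obtain \<epsilon> where \<epsilon>: "\<epsilon> > 0" "ball 0 \<epsilon> \<subseteq> {t. t *\<^sub>k x \<in> V}"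
    using openE by blast
  define t :: 'k where "t = of_real (\<epsilon> / 2)"
  have "norm t = \<epsilon> / 2"
    using \<epsilon>(1) by (simp only: t_def norm_of_real)
  then have "t \<noteq> 0" "t \<in> ball 0 \<epsilon>"
    using \<epsilon>(1) by auto
  with \<epsilon>(2) show ?thesis by blast
qed

lemma ex_openin_coefficient_less_1:
  assumes N: "closedin X N" "subspace N" and e: "e \<in> topspace X" "e \<notin> N"
  shows "\<exists>V. openin X V \<and> 0 \<in> V \<and> (\<forall>x\<in>V. \<forall>c. x - c *\<^sub>k e \<in> N \<longrightarrow> norm c < 1)"
proof (intro exI conjI ballI allI impI)
  let ?A = "{x \<in> topspace X. \<exists>s\<in>cball 0 1. e - s *\<^sub>k x \<in> N}"
  have "closedin X ?A"
    using e(1) by (intro closedin_Bex_compact[OF compact_cball N(1)] continuous_map_diff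
        continuous_map_scale continuous_map_into_fulltopology[OF continuous_map_fst]
        continuous_map_snd) simp
  then show "openin X (topspace X - ?A)" by blast
  show "0 \<in> topspace X - ?A"
    using e(2) subspace_0[OF subspace_topspace] by auto
  fix x c assume x: "x \<in> topspace X - ?A" and coeff: "x - c *\<^sub>k e \<in> N"
  show "norm c < 1"
  proof (rule ccontr)
    assume "\<not> norm c < 1"
    then have "c \<noteq> 0" "inverse c \<in> cball 0 1"
      by (auto simp: norm_inverse inverse_le_1_iff)
    have "- inverse c *\<^sub>k (x - c *\<^sub>k e) \<in> N"
      using subspace_scale[OF N(2) coeff] .
    also have "- inverse c *\<^sub>k (x - c *\<^sub>k e) = e - inverse c *\<^sub>k x"
      using \<open>c \<noteq> 0\<close> by (simp add: scale_right_diff_distrib)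
    finally show False using x \<open>inverse c \<in> cball 0 1\<close> by blast
  qed
qed

lemma ex_openin_coefficient_bounded:
  assumes N: "closedin X N" "subspace N" and e: "e \<in> topspace X" "e \<notin> N" and x: "x \<in> topspace X"
  shows "\<exists>W r. openin X W \<and> x \<in> W \<and> (\<forall>y\<in>W. \<forall>c. y - c *\<^sub>k e \<in> N \<longrightarrow> norm c \<le> r)"
proof -
  obtain V where V: "openin X V" "0 \<in> V" "\<And>y c. y \<in> V \<Longrightarrow> y - c *\<^sub>k e \<in> N \<Longrightarrow> norm c < 1"
    using ex_openin_coefficient_less_1[OF N e] by blast
  obtain t where t: "t \<noteq> 0" "t *\<^sub>k x \<in> V"
    using openin_absorbing[OF V(1,2) x] by blast
  let ?W = "{y \<in> topspace X. t *\<^sub>k y \<in> V}"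
  have "continuous_map X X ((*\<^sub>k) t)"
    by (intro continuous_map_scale) simp_all
  then have "openin X ?W"
    using V(1) by (rule openin_continuous_map_preimage)
  moreover have "x \<in> ?W" using x t(2) by simp
  moreover have "norm c \<le> inverse (norm t)" if "y \<in> ?W" and coeff: "y - c *\<^sub>k e \<in> N" for y c
  proof -
    have "t *\<^sub>k y - (t * c) *\<^sub>k e \<in> N"
      using subspace_scale[OF N(2) coeff, of t] by (simp add: scale_right_diff_distrib)
    then have "norm (t * c) < 1" using V(3) \<open>y \<in> ?W\<close> by blast
    then show ?thesis using t(1) by (simp add: norm_mult field_simps)
  qed
  ultimately show ?thesis
    by (intro exI[of _ ?W] exI[of _ "inverse (norm t)"]) simp
qed

lemma closedin_coefficient_in_cball:
  assumes "closedin X N" "e \<in> topspace X"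
  shows "closedin X {x \<in> topspace X. \<exists>c\<in>cball a r. x - c *\<^sub>k e \<in> N}"
  using assms(2) by (intro closedin_Bex_compact[OF compact_cball assms(1)] continuous_map_diff
      continuous_map_scale continuous_map_into_fulltopology[OF continuous_map_fst]
      continuous_map_snd) simp

lemma closedin_span_insert:
  assumes N: "closedin X N" "subspace N" and e: "e \<in> topspace X"
  shows "closedin X (span (insert e N))"
proof (cases "e \<in> N")
  case True
  then have "span (insert e N) = N" using N(2) by (simp add: insert_absorb)
  then show ?thesis using N(1) by simp
next
  case False
  have span_eq: "span (insert e N) = {x. \<exists>c. x - c *\<^sub>k e \<in> N}"
    unfolding span_insert span_eq_iff[THEN iffD2, OF N(2)] ..
  have "insert e N \<subseteq> topspace X"
    using e closedin_subset[OF N(1)] by simp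
  then have "span (insert e N) \<subseteq> topspace X"
    by (rule span_minimal[OF _ subspace_topspace])
  moreover have "X closure_of span (insert e N) \<subseteq> span (insert e N)"
  proof
    fix x assume x: "x \<in> X closure_of span (insert e N)"
    then have "x \<in> topspace X" by (simp add: in_closure_of)
    then obtain W r where W: "openin X W" "x \<in> W"
        and bound: "\<And>y c. y \<in> W \<Longrightarrow> y - c *\<^sub>k e \<in> N \<Longrightarrow> norm c \<le> r"
      using ex_openin_coefficient_bounded[OF N e False, of x] by blast
    have "x \<in> X closure_of (W \<inter> span (insert e N))"
      using openin_Int_closure_of_subset[OF W(1)] x W(2) by blast
    also have "\<dots> \<subseteq> {y \<in> topspace X. \<exists>c\<in>cball 0 r. y - c *\<^sub>k e \<in> N}"
    proof (rule closure_of_minimal[OF _ closedin_coefficient_in_cball[OF N(1) e]], rule subsetI)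
      fix y assume y: "y \<in> W \<inter> span (insert e N)"
      then obtain c where "y - c *\<^sub>k e \<in> N" by (auto simp: span_eq)
      then show "y \<in> {y \<in> topspace X. \<exists>c\<in>cball 0 r. y - c *\<^sub>k e \<in> N}"
        using y bound[of y c] openin_subset[OF W(1)] by auto
    qed
    finally show "x \<in> span (insert e N)" by (auto simp: span_eq)
  qed
  ultimately show ?thesis
    by (simp add: closure_of_subset_eq[symmetric])
qed

lemma continuous_map_linear_functional_of_bounded:
  assumes lin: "Vector_Spaces.linear (*\<^sub>k) (*) \<phi>"
    and V: "openin X V" "0 \<in> V" and less_1: "\<And>x. x \<in> V \<Longrightarrow> norm (\<phi> x) < 1"
  shows "continuous_map X euclidean \<phi>"
  unfolding continuous_map_def
proof (intro conjI allI impI)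
  interpret \<phi>: Vector_Spaces.linear "(*\<^sub>k)" "(*)" \<phi> by (rule lin)
  fix T :: "'k set" assume "openin euclidean T"
  show "openin X {x \<in> topspace X. \<phi> x \<in> T}"
  proof (subst openin_subopen, intro ballI)
    fix x assume "x \<in> {x \<in> topspace X. \<phi> x \<in> T}"
    then obtain \<epsilon> where x: "x \<in> topspace X" and \<epsilon>: "\<epsilon> > 0" "ball (\<phi> x) \<epsilon> \<subseteq> T"
      using \<open>openin euclidean T\<close> by (auto elim: openE)
    let ?W = "{y \<in> topspace X. of_real (inverse \<epsilon>) *\<^sub>k (y - x) \<in> V}"
    have "openin X ?W"
      using V(1) x by (intro openin_continuous_map_preimage[OF continuous_map_scale]
          continuous_map_diff) auto
    moreover have "\<phi> y \<in> T" if "y \<in> ?W" for y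
    proof -
      have "norm (\<phi> (of_real (inverse \<epsilon>) *\<^sub>k (y - x))) < 1"
        using that by (intro less_1) simp
      then have "inverse \<epsilon> * norm (\<phi> y - \<phi> x) < 1"
        using \<epsilon>(1) by (simp add: \<phi>.scale \<phi>.diff norm_mult norm_inverse)
      then have "norm (\<phi> y - \<phi> x) < \<epsilon>"
        using \<epsilon>(1) by (simp add: field_simps)
      then show ?thesis using \<epsilon>(2) by (auto simp: dist_norm norm_minus_commute)
    qed
    ultimately show "\<exists>S. openin X S \<and> x \<in> S \<and> S \<subseteq> {x \<in> topspace X. \<phi> x \<in> T}"
      using x V(2) by (intro exI[of _ ?W]) auto
  qed
qed simp

lemma continuous_map_linear_functional_of_closed_kernel:
  assumes lin: "Vector_Spaces.linear (*\<^sub>k) (*) \<phi>"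
    and kernel: "closedin X {x \<in> topspace X. \<phi> x = 0}" (is "closedin X ?N")
  shows "continuous_map X euclidean \<phi>"
proof (cases "\<forall>x\<in>topspace X. \<phi> x = 0")
  case True
  then show ?thesis
    using continuous_map_eq[of X euclidean "\<lambda>_. 0" \<phi>] by simp
next
  case False
  interpret \<phi>: Vector_Spaces.linear "(*\<^sub>k)" "(*)" \<phi> by (rule lin)
  note topspace_closed = subspace_add[OF subspace_topspace] subspace_scale[OF subspace_topspace]
    subspace_diff[OF subspace_topspace]
  have subspace: "subspace ?N"
    unfolding subspace_def using subspace_0[OF subspace_topspace]
    by (auto simp: topspace_closed \<phi>.add \<phi>.scale \<phi>.zero)
  obtain x where "x \<in> topspace X" "\<phi> x \<noteq> 0" using False by blast
  then obtain e where e: "e \<in> topspace X" "\<phi> e = 1"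
    using that[of "inverse (\<phi> x) *\<^sub>k x"] by (simp add: topspace_closed \<phi>.scale)
  then have "e \<notin> ?N" by simp
  then obtain V where V: "openin X V" "0 \<in> V" "\<And>x c. x \<in> V \<Longrightarrow> x - c *\<^sub>k e \<in> ?N \<Longrightarrow> norm c < 1"
    using ex_openin_coefficient_less_1[OF kernel subspace e(1)] by blast
  show ?thesis
  proof (rule continuous_map_linear_functional_of_bounded[OF lin V(1,2)])
    fix x assume "x \<in> V"
    then have "x \<in> topspace X" using openin_subset[OF V(1)] by blast
    then have "x - \<phi> x *\<^sub>k e \<in> ?N"
      using e by (simp add: topspace_closed \<phi>.diff \<phi>.scale)
    then show "norm (\<phi> x) < 1" by (rule V(3)[OF \<open>x \<in> V\<close>])
  qed
qed

lemma ex_continuous_linear_functional: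
  assumes N: "closedin X N" "subspace N" and "e \<notin> N" and span: "span (insert e N) = topspace X"
  shows "\<exists>\<phi>. Vector_Spaces.linear (*\<^sub>k) (*) \<phi> \<and> continuous_map X euclidean \<phi> \<and>
    (\<forall>x\<in>N. \<phi> x = 0) \<and> \<phi> e = 1"
proof -
  obtain \<phi> where \<phi>: "Vector_Spaces.linear (*\<^sub>k) (*) \<phi>" "\<And>x. x \<in> N \<Longrightarrow> \<phi> x = 0" "\<phi> e = 1"
    using ex_linear_functional[OF N(2) \<open>e \<notin> N\<close>] by blast
  interpret \<phi>: Vector_Spaces.linear "(*\<^sub>k)" "(*)" \<phi> by (rule \<phi>(1))
  have "x \<in> N" if "x \<in> topspace X" "\<phi> x = 0" for x
  proof -
    obtain c where "x - c *\<^sub>k e \<in> N"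
      using \<open>x \<in> topspace X\<close>
      unfolding span[symmetric] span_insert span_eq_iff[THEN iffD2, OF N(2)] by blast
    moreover from this have "c = 0"
      using \<phi>(2)[of "x - c *\<^sub>k e"] \<phi>(3) \<open>\<phi> x = 0\<close> by (simp add: \<phi>.diff \<phi>.scale)
    ultimately show ?thesis by simp
  qed
  then have "{x \<in> topspace X. \<phi> x = 0} = N"
    using \<phi>(2) closedin_subset[OF N(1)] by blast
  then have "continuous_map X euclidean \<phi>"
    using N(1) by (intro continuous_map_linear_functional_of_closed_kernel[OF \<phi>(1)]) simp
  with \<phi> show ?thesis by blast
qed

end

subsection \<open>Closure operators on ideals\<close>

text \<open>
  For a ring acting on itself, \<open>cring.scale_scale\<close> reads \<open>a * (b * x) = (a * b) * x\<close>: as a simp rule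
  it loops with \<open>mult.assoc\<close>.
\<close>

declare cring.scale_scale [simp del]

abbreviation ideal :: "'a::comm_ring_1 set \<Rightarrow> bool" where
  "ideal \<equiv> cring.subspace"

lemma in_ideal_span_insert_iff:
  fixes K :: "'a::comm_ring_1 set"
  assumes "ideal K"
  shows "x \<in> cring.span (insert a K) \<longleftrightarrow> (\<exists>k. x - k * a \<in> K)"
  using assms by (simp only: cring.span_insert mem_Collect_eq cring.span_eq_iff[THEN iffD2])

locale ideal_closure =
  fixes C :: "'a::comm_ring_1 set \<Rightarrow> 'a set"
  assumes extensive: "K \<subseteq> C K"
    and least: "K \<subseteq> C K' \<Longrightarrow> C K \<subseteq> C K'"
    and closure_ideal: "ideal K \<Longrightarrow> ideal (C K)"
    and mult_closure: "p \<in> C K \<Longrightarrow> a * p \<in> C ((*) a ` K)"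
begin

definition dense :: "'a set \<Rightarrow> bool" where
  "dense K \<longleftrightarrow> 1 \<in> C K"

lemma closure_mono: "K \<subseteq> K' \<Longrightarrow> C K \<subseteq> C K'"
  using extensive least by blast

lemma dense_mono: "K \<subseteq> K' \<Longrightarrow> dense K \<Longrightarrow> dense K'"
  using closure_mono[of K K'] by (auto simp: dense_def)

lemma dense_of_multiple:
  assumes I: "ideal I" "K \<subseteq> I" "(*) a ` J \<subseteq> I"
    and "dense J" "dense (cring.span (insert a K))"
  shows "dense I"
proof -
  have "a * 1 \<in> C ((*) a ` J)"
    using \<open>dense J\<close> unfolding dense_def by (rule mult_closure)
  then have "a \<in> C I" using closure_mono[OF I(3)] by auto
  then have "insert a K \<subseteq> C I" using I(2) extensive by blast
  then have "cring.span (insert a K) \<subseteq> C I"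
    using closure_ideal[OF I(1)] by (rule cring.span_minimal)
  from subsetD[OF least[OF this]] show ?thesis
    using assms(5) by (simp add: dense_def)
qed

lemma dense_span_insert_mult:
  assumes K: "ideal K" and "dense (cring.span (insert a K))" "dense (cring.span (insert b K))"
  shows "dense (cring.span (insert (a * b) K))"
proof (rule dense_of_multiple[where K = K and J = "cring.span (insert b K)"])
  show "(*) a ` cring.span (insert b K) \<subseteq> cring.span (insert (a * b) K)"
  proof (intro image_subsetI)
    fix x assume "x \<in> cring.span (insert b K)"
    then obtain k where "x - k * b \<in> K"
      unfolding in_ideal_span_insert_iff[OF K] ..
    then have "a * (x - k * b) \<in> K"
      by (rule cring.subspace_scale[OF K])
    also have "a * (x - k * b) = a * x - k * (a * b)"
      by (simp add: right_diff_distrib mult.left_commute)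
    finally show "a * x \<in> cring.span (insert (a * b) K)"
      unfolding in_ideal_span_insert_iff[OF K] ..
  qed
  show "K \<subseteq> cring.span (insert (a * b) K)"
    using cring.span_superset[of "insert (a * b) K"] by blast
qed (use assms in simp_all)

lemma dense_span_insert_prod_mset:
  assumes "ideal K" and "\<And>i. i \<in># A \<Longrightarrow> dense (cring.span (insert (f i) K))"
  shows "dense (cring.span (insert (\<Prod>i\<in>#A. f i) K))"
  using assms(2)
proof (induction A)
  case empty
  have "1 \<in> cring.span (insert 1 K)" by (rule cring.span_base) simp
  then show ?case using extensive by (auto simp: dense_def)
next
  case (add i A)
  then show ?case using dense_span_insert_mult[OF assms(1)] by simp
qed

lemma ex_factor_not_dense:
  assumes K: "ideal K" "\<not> dense K" and "(\<Prod>i\<in>#A. f i) \<in> K"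
  shows "\<exists>i. i \<in># A \<and> \<not> dense (cring.span (insert (f i) K))"
proof (rule ccontr)
  assume "\<not> ?thesis"
  then have "dense (cring.span (insert (\<Prod>i\<in>#A. f i) K))"
    by (intro dense_span_insert_prod_mset[OF K(1)]) blast
  also have "cring.span (insert (\<Prod>i\<in>#A. f i) K) = K"
    using assms by (simp add: insert_absorb)
  finally show False using K(2) by contradiction
qed

lemma ex_not_dense_ideal_meeting:
  assumes "finite V" "ideal J" "\<not> dense J"
    and adjoin: "\<And>K i. i \<in> V \<Longrightarrow> ideal K \<Longrightarrow> J \<subseteq> K \<Longrightarrow> \<not> dense K \<Longrightarrow>
      \<exists>a\<in>A i. \<not> dense (cring.span (insert a K))"
  shows "\<exists>K. ideal K \<and> J \<subseteq> K \<and> \<not> dense K \<and> (\<forall>i\<in>V. A i \<inter> K \<noteq> {})"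
  using assms(1) adjoin
proof (induction V rule: finite_induct)
  case empty
  show ?case using assms(2,3) by blast
next
  case (insert i V)
  have "\<exists>K. ideal K \<and> J \<subseteq> K \<and> \<not> dense K \<and> (\<forall>j\<in>V. A j \<inter> K \<noteq> {})"
    by (rule insert.IH) (rule insert.prems[OF insertI2])
  then obtain K where K: "ideal K" "J \<subseteq> K" "\<not> dense K" "\<forall>j\<in>V. A j \<inter> K \<noteq> {}"
    by blast
  obtain a where a: "a \<in> A i" "\<not> dense (cring.span (insert a K))"
    using insert.prems[OF insertI1 K(1-3)] by blast
  have insert_subset_span: "insert a K \<subseteq> cring.span (insert a K)"
    by (rule cring.span_superset)
  show ?case
  proof (intro exI conjI)
    show "ideal (cring.span (insert a K))" by simp
    show "J \<subseteq> cring.span (insert a K)" using K(2) insert_subset_span by blast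
    show "\<not> dense (cring.span (insert a K))" by (rule a(2))
    show "\<forall>j\<in>insert i V. A j \<inter> cring.span (insert a K) \<noteq> {}"
      using K(4) a(1) insert_subset_span by blast
  qed
qed

end

lemma ideal_closure_id: "ideal_closure (\<lambda>K. K)"
  by unfold_locales auto

lemma dense_id_iff [simp]: "ideal_closure.dense (\<lambda>K. K) K \<longleftrightarrow> 1 \<in> K"
  by (simp add: ideal_closure.dense_def[OF ideal_closure_id])

subsection \<open>Algebras over a field\<close>

lemma sum_prod_remove_in_ideal:
  assumes J: "ideal J" and "finite T" and inv: "\<And>c. c \<in> T \<Longrightarrow> 1 - r c * y c \<in> J"
    and sum_eq_0: "(\<Sum>c\<in>T. u c * r c) = 0"
  shows "(\<Sum>c\<in>T. u c * (\<Prod>b\<in>T - {c}. y b)) \<in> J"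
proof -
  let ?q = "\<lambda>S. \<Prod>b\<in>S. y b"
  have "u c * ?q (T - {c}) = u c * ?q (T - {c}) * (1 - r c * y c) + ?q T * (u c * r c)"
    if "c \<in> T" for c
    unfolding prod.remove[OF \<open>finite T\<close> that, of y] by (simp add: algebra_simps)
  then have "(\<Sum>c\<in>T. u c * ?q (T - {c}))
      = (\<Sum>c\<in>T. u c * ?q (T - {c}) * (1 - r c * y c)) + ?q T * (\<Sum>c\<in>T. u c * r c)"
    unfolding sum_distrib_left sum.distrib[symmetric] by (rule sum.cong[OF refl])
  also have "\<dots> \<in> J"
    unfolding sum_eq_0 mult_zero_right add_0_right
    using inv by (intro cring.subspace_sum[OF J] cring.subspace_scale[OF J])
  finally show ?thesis .
qed

lemma sum_smult_prod_linear_nonzero: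
  fixes u :: "'k::field \<Rightarrow> 'k"
  assumes "finite T" "a \<in> T" "u a \<noteq> 0"
  shows "(\<Sum>c\<in>T. smult (u c) (\<Prod>b\<in>T - {c}. [:- b, 1:])) \<noteq> 0" (is "?p \<noteq> 0")
proof -
  have "poly ?p a = (\<Sum>c\<in>T. u c * (\<Prod>b\<in>T - {c}. a - b))"
    by (simp add: poly_sum poly_prod)
  also have "\<dots> = (\<Sum>c\<in>{a}. u c * (\<Prod>b\<in>T - {c}. a - b))"
    using assms by (intro sum.mono_neutral_right) auto
  also have "\<dots> \<noteq> 0" using assms by simp
  finally show ?thesis by auto
qed

locale field_algebra =
  fixes \<iota> :: "'k::field \<Rightarrow> 'a::comm_ring_1"
  assumes embed_add: "\<iota> (a + b) = \<iota> a + \<iota> b"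
    and embed_mult: "\<iota> (a * b) = \<iota> a * \<iota> b"
    and embed_1 [simp]: "\<iota> 1 = 1"
begin

sublocale vec: vector_space "\<lambda>c x. \<iota> c * x"
  by unfold_locales (simp_all add: embed_add embed_mult algebra_simps)

lemma embed_0 [simp]: "\<iota> 0 = 0"
  using embed_add[of 0 0] by simp

lemma embed_uminus: "\<iota> (- a) = - \<iota> a"
  using embed_add[of a "- a"] by (simp add: eq_neg_iff_add_eq_0 add.commute)

lemma in_ideal_cancel_embed:
  assumes J: "ideal J" and "c \<noteq> 0" "\<iota> c * x \<in> J"
  shows "x \<in> J"
proof -
  have "\<iota> (inverse c) * (\<iota> c * x) \<in> J"
    using assms(3) by (rule cring.subspace_scale[OF J])
  also have "\<iota> (inverse c) * (\<iota> c * x) = \<iota> (inverse c * c) * x"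
    by (simp only: embed_mult mult.assoc)
  also have "\<dots> = x" using \<open>c \<noteq> 0\<close> by simp
  finally show ?thesis .
qed

definition poly_at :: "'k poly \<Rightarrow> 'a \<Rightarrow> 'a" where
  "poly_at p x = poly (map_poly \<iota> p) x"

lemma poly_at_0 [simp]: "poly_at 0 x = 0"
  by (simp add: poly_at_def)

lemma poly_at_pCons [simp]: "poly_at (pCons a p) x = \<iota> a + x * poly_at p x"
  by (simp add: poly_at_def map_poly_pCons)

lemma poly_at_1 [simp]: "poly_at 1 x = 1"
  by (simp add: one_pCons)

lemma poly_at_add [simp]: "poly_at (p + q) x = poly_at p x + poly_at q x"
  by (induction p q rule: poly_induct2) (simp_all add: embed_add algebra_simps)

lemma poly_at_smult [simp]: "poly_at (smult a p) x = \<iota> a * poly_at p x"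
  by (induction p) (simp_all add: embed_mult algebra_simps)

lemma poly_at_mult [simp]: "poly_at (p * q) x = poly_at p x * poly_at q x"
  by (induction p) (simp_all add: distrib_right mult.assoc del: mult_pCons_right)

lemma poly_at_sum: "poly_at (\<Sum>i\<in>A. f i) x = (\<Sum>i\<in>A. poly_at (f i) x)"
  by (induction A rule: infinite_finite_induct) simp_all

lemma poly_at_prod_mset: "poly_at (\<Prod>i\<in>#A. f i) x = (\<Prod>i\<in>#A. poly_at (f i) x)"
  by (induction A) simp_all

lemma poly_at_prod: "poly_at (\<Prod>i\<in>A. f i) x = (\<Prod>i\<in>A. poly_at (f i) x)"
  by (simp add: prod_unfold_prod_mset poly_at_prod_mset)

lemma poly_at_linear: "poly_at [:- c, 1:] x = x - \<iota> c"
  by (simp add: embed_uminus)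

end

locale alg_closed_field_algebra = field_algebra \<iota>
  for \<iota> :: "'k::alg_closed_field \<Rightarrow> 'a::comm_ring_1"
begin

lemma ex_prod_linear_in_ideal:
  assumes J: "ideal J" and "p \<noteq> 0" "poly_at p x \<in> J"
  shows "\<exists>A. (\<Prod>c\<in>#A. x - \<iota> c) \<in> J"
proof -
  obtain A where A: "p = smult (lead_coeff p) (\<Prod>c\<in>#A. [:- c, 1:])"
    using alg_closed_imp_factorization[OF \<open>p \<noteq> 0\<close>] by blast
  have "poly_at p x = \<iota> (lead_coeff p) * (\<Prod>c\<in>#A. x - \<iota> c)"
    by (subst A) (simp only: poly_at_smult poly_at_prod_mset poly_at_linear)
  then have "(\<Prod>c\<in>#A. x - \<iota> c) \<in> J"
    using assms in_ideal_cancel_embed[OF J, of "lead_coeff p"] by simp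
  then show ?thesis ..
qed

lemma ex_prod_linear_in_ideal_of_uncountable:
  assumes J: "ideal J" and dim: "countable B" "vec.span B = UNIV" and "uncountable \<Lambda>"
    and unit: "\<And>c. c \<in> \<Lambda> \<Longrightarrow> 1 \<in> cring.span (insert (x - \<iota> c) J)"
  shows "\<exists>A. (\<Prod>c\<in>#A. x - \<iota> c) \<in> J"
proof -
  have "\<exists>r. 1 - r * (x - \<iota> c) \<in> J" if "c \<in> \<Lambda>" for c
    using unit[OF that] unfolding in_ideal_span_insert_iff[OF J] .
  then obtain r where r: "\<And>c. c \<in> \<Lambda> \<Longrightarrow> 1 - r c * (x - \<iota> c) \<in> J"
    by metis
  obtain T u where T: "finite T" "T \<subseteq> \<Lambda>" "\<exists>c\<in>T. u c \<noteq> 0" "(\<Sum>c\<in>T. \<iota> (u c) * r c) = 0"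
    using vec.ex_linear_relation_of_uncountable[OF dim(1) \<open>uncountable \<Lambda>\<close>, of r] dim(2) by auto
  let ?p = "\<Sum>c\<in>T. smult (u c) (\<Prod>b\<in>T - {c}. [:- b, 1:])"
  have "poly_at ?p x = (\<Sum>c\<in>T. \<iota> (u c) * (\<Prod>b\<in>T - {c}. x - \<iota> b))"
    by (simp only: poly_at_sum poly_at_smult poly_at_prod poly_at_linear)
  also have "\<dots> \<in> J"
    using T(2) r by (intro sum_prod_remove_in_ideal[OF J T(1) _ T(4)]) blast
  finally show ?thesis
    using ex_prod_linear_in_ideal[OF J] sum_smult_prod_linear_nonzero[OF T(1)] T(3) by blast
qed

end

subsection \<open>Polynomials in several variables\<close>

lemma poly_mapping_single_add_induct [case_names zero single add]:
  fixes p :: "'a \<Rightarrow>\<^sub>0 'b::comm_monoid_add"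
  assumes zero: "Q 0"
    and single: "\<And>a b. Q (Poly_Mapping.single a b)"
    and add: "\<And>p q. Q p \<Longrightarrow> Q q \<Longrightarrow> Q (p + q)"
  shows "Q p"
proof (induction p rule: Poly_Mapping.update_induct)
  case const
  show ?case by (rule zero)
next
  case (update f a b)
  have "Poly_Mapping.update a b f = Poly_Mapping.single a b + f"
    using update by (intro poly_mapping_eqI)
      (auto simp: lookup_update lookup_add lookup_single in_keys_iff when_def)
  then show ?case using add[OF single update(3)] by simp
qed

definition cpoly_const :: "complex \<Rightarrow> 'n::finite cpoly" where
  "cpoly_const c = Poly_Mapping.single 0 c"

definition cpoly_var :: "'n::finite \<Rightarrow> 'n cpoly" where
  "cpoly_var j = Poly_Mapping.single (Poly_Mapping.single j 1) 1"

interpretation cpoly: alg_closed_field_algebra cpoly_const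
  by unfold_locales (simp_all add: cpoly_const_def single_add mult_single)

lemma cpoly_single_eq_const_mult:
  "Poly_Mapping.single m c = cpoly_const c * Poly_Mapping.single m 1"
  by (simp add: cpoly_const_def mult_single)

lemma cpoly_span_monomials:
  "cpoly.vec.span (range (\<lambda>m. Poly_Mapping.single m 1)) = (UNIV :: 'n::finite cpoly set)"
    (is "cpoly.vec.span ?B = _")
proof -
  have "P \<in> cpoly.vec.span ?B" for P :: "'n cpoly"
  proof (induction P rule: poly_mapping_single_add_induct)
    case zero
    show ?case by (rule cpoly.vec.span_zero)
  next
    case (single m c)
    show ?case
      unfolding cpoly_single_eq_const_mult[of m c]
      by (intro cpoly.vec.span_scale cpoly.vec.span_base rangeI)
  next
    case (add P Q)
    then show ?case by (rule cpoly.vec.span_add)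
  qed
  then show ?thesis by blast
qed

lemma countable_poly_mapping: "countable (UNIV :: ('a::finite \<Rightarrow>\<^sub>0 'b::{countable,zero}) set)"
proof (rule countableI')
  show "inj (\<lambda>m::'a \<Rightarrow>\<^sub>0 'b. to_nat (Poly_Mapping.lookup m))"
    by (simp add: inj_def)
qed

lemma cpoly_induct [case_names const var add mult]:
  fixes P :: "'n::finite cpoly"
  assumes const: "\<And>c. Q (cpoly_const c)"
    and var: "\<And>j. Q (cpoly_var j)"
    and add: "\<And>P R. Q P \<Longrightarrow> Q R \<Longrightarrow> Q (P + R)"
    and mult: "\<And>P R. Q P \<Longrightarrow> Q R \<Longrightarrow> Q (P * R)"
  shows "Q P"
proof (induction P rule: poly_mapping_single_add_induct)
  case zero
  show ?case using const[of 0] by simp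
next
  case (single m c)
  have "Q (Poly_Mapping.single m 1)"
  proof (induction m rule: poly_mapping_single_add_induct)
    case zero
    show ?case using const[of 1] by simp
  next
    case (single j k)
    show ?case
    proof (induction k)
      case 0
      show ?case using const[of 1] by simp
    next
      case (Suc k)
      have "Poly_Mapping.single (Poly_Mapping.single j (Suc k)) 1
          = cpoly_var j * Poly_Mapping.single (Poly_Mapping.single j k) (1::complex)"
        by (simp add: cpoly_var_def mult_single flip: single_add)
      then show ?case using mult[OF var Suc] by simp
    qed
  next
    case (add m m')
    then show ?case
      using mult[OF add] by (simp add: mult_single)
  qed
  then show ?case
    unfolding cpoly_single_eq_const_mult[of m c] by (rule mult[OF const])
qed (rule add)

lemma cpoly_eval_superset:
  assumes "finite S" "Poly_Mapping.keys P \<subseteq> S"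
  shows "cpoly_eval P z =
    (\<Sum>m\<in>S. Poly_Mapping.lookup P m * (\<Prod>j\<in>UNIV. (z $ j) ^ Poly_Mapping.lookup m j))"
  unfolding cpoly_eval_def
  by (rule sum.mono_neutral_left) (use assms in \<open>auto simp: in_keys_iff\<close>)

lemma cpoly_eval_0 [simp]: "cpoly_eval 0 z = 0"
  by (simp add: cpoly_eval_def)

lemma cpoly_eval_add [simp]: "cpoly_eval (P + Q) z = cpoly_eval P z + cpoly_eval Q z"
proof -
  let ?S = "Poly_Mapping.keys P \<union> Poly_Mapping.keys Q"
  have "finite ?S" "Poly_Mapping.keys (P + Q) \<subseteq> ?S"
    by (auto simp: Poly_Mapping.keys_add)
  then show ?thesis
    by (simp add: cpoly_eval_superset[where S = ?S] lookup_add distrib_right sum.distrib)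
qed

lemma cpoly_eval_single:
  "cpoly_eval (Poly_Mapping.single m c) z = c * (\<Prod>j\<in>UNIV. (z $ j) ^ Poly_Mapping.lookup m j)"
  by (subst cpoly_eval_superset[where S = "{m}"]) auto

lemma cpoly_eval_mult [simp]: "cpoly_eval (P * Q) z = cpoly_eval P z * cpoly_eval Q z"
proof (induction P rule: poly_mapping_single_add_induct)
  case (single m c)
  show ?case
    by (induction Q rule: poly_mapping_single_add_induct)
      (simp_all add: mult_single cpoly_eval_single lookup_add power_add prod.distrib distrib_left)
qed (simp_all add: distrib_right)

lemma cpoly_eval_const [simp]: "cpoly_eval (cpoly_const c) z = c"
  by (simp add: cpoly_const_def cpoly_eval_single)

lemma cpoly_eval_1 [simp]: "cpoly_eval 1 z = 1"
  using cpoly_eval_const[of 1 z] by simp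

lemma cpoly_eval_diff [simp]: "cpoly_eval (P - Q) z = cpoly_eval P z - cpoly_eval Q z"
  using cpoly_eval_add[of "P - Q" Q z] by simp

lemma cpoly_eval_var [simp]: "cpoly_eval (cpoly_var j) z = z $ j"
proof -
  have "(\<Prod>i\<in>UNIV. (z $ i) ^ Poly_Mapping.lookup (Poly_Mapping.single j 1) i)
      = (\<Prod>i\<in>UNIV. if i = j then z $ i else 1)"
    by (intro prod.cong) (auto simp: lookup_single when_def)
  then show ?thesis
    by (simp add: cpoly_var_def cpoly_eval_single)
qed

lemma zero_set_ideal_gen: "zero_set (ideal_gen \<F>) = zero_set \<F>"
proof
  show "zero_set (ideal_gen \<F>) \<subseteq> zero_set \<F>"
    using cring.span_superset[of \<F>] by (auto simp: zero_set_def ideal_gen_def)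
  show "zero_set \<F> \<subseteq> zero_set (ideal_gen \<F>)"
  proof
    fix w assume w: "w \<in> zero_set \<F>"
    have "cpoly_eval P w = 0" if "P \<in> cring.span \<F>" for P
      using that
      by (induction rule: cring.span_induct_alt) (use w in \<open>auto simp: zero_set_def\<close>)
    then show "w \<in> zero_set (ideal_gen \<F>)"
      by (simp add: zero_set_def ideal_gen_def)
  qed
qed

subsection \<open>Maximal ideals and the Nullstellensatz\<close>

definition point_ideal :: "complex ^ 'n::finite \<Rightarrow> 'n cpoly set" where
  "point_ideal w = {P. cpoly_eval P w = 0}"

lemma ideal_point_ideal: "ideal (point_ideal w)"
  by (simp add: cring.subspace_def point_ideal_def)

lemma diff_cpoly_eval_in_ideal:
  assumes K: "ideal K" and "\<And>j. cpoly_var j - cpoly_const (w $ j) \<in> K"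
  shows "P - cpoly_const (cpoly_eval P w) \<in> K"
proof (induction P rule: cpoly_induct)
  case (const c)
  show ?case using K by (simp add: cring.subspace_0)
next
  case (var j)
  show ?case using assms(2) by simp
next
  case (add P R)
  from cring.subspace_add[OF K add] show ?case
    by (simp add: cpoly.embed_add algebra_simps)
next
  case (mult P R)
  have "R * (P - cpoly_const (cpoly_eval P w))
      + cpoly_const (cpoly_eval P w) * (R - cpoly_const (cpoly_eval R w)) \<in> K"
    using mult by (intro cring.subspace_add[OF K] cring.subspace_scale[OF K])
  then show ?case
    by (simp add: cpoly.embed_mult algebra_simps)
qed

lemma ideal_eq_point_ideal:
  assumes K: "ideal K" "1 \<notin> K" and "\<And>j. cpoly_var j - cpoly_const (w $ j) \<in> K"
  shows "K = point_ideal w"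
proof
  note diff_in_K = diff_cpoly_eval_in_ideal[OF K(1) assms(3)]
  show "K \<subseteq> point_ideal w"
  proof
    fix P assume "P \<in> K"
    have "cpoly_eval P w = 0"
    proof (rule ccontr)
      assume nonzero: "cpoly_eval P w \<noteq> 0"
      have "P - (P - cpoly_const (cpoly_eval P w)) \<in> K"
        using \<open>P \<in> K\<close> diff_in_K by (rule cring.subspace_diff[OF K(1)])
      then have "1 \<in> K"
        using cpoly.in_ideal_cancel_embed[OF K(1) nonzero, of 1] by simp
      with K(2) show False ..
    qed
    then show "P \<in> point_ideal w" by (simp add: point_ideal_def)
  qed
  show "point_ideal w \<subseteq> K"
  proof
    fix P assume "P \<in> point_ideal w"
    then show "P \<in> K" using diff_in_K[of P] by (simp add: point_ideal_def)
  qed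
qed

lemma ex_zero_not_dense:
  fixes J :: "'n::finite cpoly set"
  assumes "ideal_closure C" and J: "ideal J" "\<not> ideal_closure.dense C J"
    and adjoin: "\<And>K j. ideal K \<Longrightarrow> J \<subseteq> K \<Longrightarrow> \<not> ideal_closure.dense C K \<Longrightarrow>
      \<exists>c. \<not> ideal_closure.dense C (cring.span (insert (cpoly_var j - cpoly_const c) K))"
  shows "\<exists>w\<in>zero_set J. \<not> ideal_closure.dense C (point_ideal w)"
proof -
  interpret ideal_closure C by fact
  let ?A = "\<lambda>j. range (\<lambda>c. cpoly_var j - cpoly_const c)"
  have "\<exists>K. ideal K \<and> J \<subseteq> K \<and> \<not> dense K \<and> (\<forall>j\<in>UNIV. ?A j \<inter> K \<noteq> {})"
  proof (rule ex_not_dense_ideal_meeting[OF finite J])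
    show "\<exists>a\<in>?A j. \<not> dense (cring.span (insert a K))"
      if "ideal K" "J \<subseteq> K" "\<not> dense K" for K j
      using adjoin[OF that, of j] by blast
  qed
  then obtain K where K: "ideal K" "J \<subseteq> K" "\<not> dense K" "\<forall>j. \<exists>c. cpoly_var j - cpoly_const c \<in> K"
    by blast
  obtain u where "\<And>j. cpoly_var j - cpoly_const (u j) \<in> K"
    using K(4) by metis
  moreover have "1 \<notin> K" using K(3) extensive by (auto simp: dense_def)
  ultimately have "K = point_ideal (\<chi> j. u j)"
    using K(1) by (intro ideal_eq_point_ideal) auto
  moreover from this have "(\<chi> j. u j) \<in> zero_set J"
    using K(2) by (auto simp: zero_set_def point_ideal_def)
  ultimately show ?thesis using K(3) by blast
qed

lemma ex_prod_linear_in_cpoly_ideal_of_uncountable: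
  fixes J :: "'n::finite cpoly set"
  assumes "ideal J" "uncountable \<Lambda>"
    and "\<And>c. c \<in> \<Lambda> \<Longrightarrow> 1 \<in> cring.span (insert (x - cpoly_const c) J)"
  shows "\<exists>A. (\<Prod>c\<in>#A. x - cpoly_const c) \<in> J"
  using assms cpoly_span_monomials
  by (intro cpoly.ex_prod_linear_in_ideal_of_uncountable
      [of J "range (\<lambda>m. Poly_Mapping.single m 1)" \<Lambda>] countable_image countable_poly_mapping)

lemma weak_nullstellensatz:
  fixes J :: "'n::finite cpoly set"
  assumes "ideal J" "1 \<notin> J"
  shows "zero_set J \<noteq> {}"
proof -
  interpret ideal_closure "\<lambda>K. K :: 'n cpoly set" by (rule ideal_closure_id)
  have "\<exists>w\<in>zero_set J. \<not> dense (point_ideal w)"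
  proof (rule ex_zero_not_dense[OF ideal_closure_id])
    fix K :: "'n cpoly set" and j
    assume K: "ideal K" "\<not> dense K"
    show "\<exists>c. \<not> dense (cring.span (insert (cpoly_var j - cpoly_const c) K))"
    proof (rule ccontr)
      assume all_dense: "\<not> ?thesis"
      then obtain A where "(\<Prod>c\<in>#A. cpoly_var j - cpoly_const c) \<in> K"
        using ex_prod_linear_in_cpoly_ideal_of_uncountable[OF K(1) uncountable_UNIV_complex] by auto
      then show False
        using ex_factor_not_dense[OF K] all_dense by blast
    qed
  qed (use assms in simp_all)
  then show ?thesis by blast
qed

lemma ex_prod_linear_in_ideal_of_finite_zero_set:
  fixes J :: "'n::finite cpoly set"
  assumes J: "ideal J" and "finite (zero_set J)"
  shows "\<exists>A. (\<Prod>c\<in>#A. cpoly_var j - cpoly_const c) \<in> J"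
proof (rule ex_prod_linear_in_cpoly_ideal_of_uncountable[OF J])
  have "countable ((\<lambda>w. w $ j) ` zero_set J)"
    using assms by (intro countable_finite) auto
  then show "uncountable (UNIV - (\<lambda>w. w $ j) ` zero_set J)"
    using uncountable_UNIV_complex uncountable_minus_countable by blast
next
  fix c assume c: "c \<in> UNIV - (\<lambda>w. w $ j) ` zero_set J"
  let ?K = "cring.span (insert (cpoly_var j - cpoly_const c) J)"
  have "zero_set ?K = {}"
    using c unfolding ideal_gen_def[symmetric] zero_set_ideal_gen
    by (auto simp: zero_set_def image_iff)
  then show "1 \<in> ?K"
    using weak_nullstellensatz[OF cring.subspace_span] by blast
qed

subsection \<open>Density of ideals in the function space\<close>

lemma poly_on_0: "poly_on \<Omega> 0 = 0"
  by (auto simp: poly_on_def)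

lemma poly_on_add: "poly_on \<Omega> (P + Q) = poly_on \<Omega> P + poly_on \<Omega> Q"
  by (auto simp: poly_on_def)

lemma poly_on_mult: "poly_on \<Omega> (P * Q) = (\<lambda>z. cpoly_eval P z * poly_on \<Omega> Q z)"
  by (auto simp: poly_on_def)

lemma poly_on_const_mult: "poly_on \<Omega> (cpoly_const c * P) = (\<lambda>z. c * poly_on \<Omega> P z)"
  by (simp add: poly_on_mult)

lemma subspace_image_poly_on:
  assumes K: "ideal K"
  shows "cfun.subspace (poly_on \<Omega> ` K)"
  unfolding cfun.subspace_def
proof (intro conjI ballI allI)
  show "0 \<in> poly_on \<Omega> ` K"
    using cring.subspace_0[OF K] by (intro image_eqI[of _ _ 0]) (simp_all add: poly_on_0)
next
  fix F G assume "F \<in> poly_on \<Omega> ` K" "G \<in> poly_on \<Omega> ` K"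
  then show "F + G \<in> poly_on \<Omega> ` K"
    using cring.subspace_add[OF K] by (auto simp flip: poly_on_add)
next
  fix c F assume "F \<in> poly_on \<Omega> ` K"
  then show "(\<lambda>z. c * F z) \<in> poly_on \<Omega> ` K"
    using cring.subspace_scale[OF K] by (auto simp flip: poly_on_const_mult)
qed

lemma poly_on_eq_diff_const_plus:
  "poly_on \<Omega> P = poly_on \<Omega> (P - cpoly_const c) + (\<lambda>z. c * poly_on \<Omega> 1 z)"
  by (auto simp: poly_on_def)

locale poly_space =
  fixes \<Omega> :: "(complex ^ 'n::finite) set" and X :: "'n cfun topology"
  assumes hausdorff_tvs: "hausdorff_tvs_in_Hol \<Omega> X" and P1: "P1 \<Omega> X" and P3: "P3 X"
begin

sublocale tvs: topological_vector_space "\<lambda>c F z. c * F z" X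
  using hausdorff_tvs by unfold_locales (simp_all add: hausdorff_tvs_in_Hol_def)

lemma poly_on_in_topspace: "poly_on \<Omega> P \<in> topspace X"
  using P1 by (auto simp: P1_def)

lemma closure_range_poly_on: "X closure_of range (poly_on \<Omega>) = topspace X"
  using P1 by (simp add: P1_def)

lemma continuous_map_cpoly_mult: "continuous_map X X (\<lambda>F z. cpoly_eval P z * F z)"
proof (induction P rule: cpoly_induct)
  case (const c)
  show ?case
    using tvs.continuous_map_scale[of X "\<lambda>_. c" "\<lambda>F. F"] by simp
next
  case (var j)
  show ?case using P3 by (simp add: P3_def)
next
  case (add P R)
  have "(\<lambda>F z. cpoly_eval (P + R) z * F z)
      = (\<lambda>F. (\<lambda>z. cpoly_eval P z * F z) + (\<lambda>z. cpoly_eval R z * F z))"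
    by (simp add: fun_eq_iff distrib_right)
  then show ?case using tvs.continuous_map_add[OF add] by simp
next
  case (mult P R)
  from continuous_map_compose[OF mult(2,1)] show ?case
    by (simp add: o_def mult.assoc)
qed

definition poly_closure :: "'n cpoly set \<Rightarrow> 'n cpoly set" where
  "poly_closure K = {P. poly_on \<Omega> P \<in> X closure_of (poly_on \<Omega> ` K)}"

lemma mult_in_poly_closure:
  assumes "P \<in> poly_closure K"
  shows "Q * P \<in> poly_closure ((*) Q ` K)"
proof -
  have "(\<lambda>F z. cpoly_eval Q z * F z) ` (X closure_of (poly_on \<Omega> ` K))
      \<subseteq> X closure_of ((\<lambda>F z. cpoly_eval Q z * F z) ` poly_on \<Omega> ` K)"
    by (rule continuous_map_image_closure_subset[OF continuous_map_cpoly_mult])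
  also have "(\<lambda>F z. cpoly_eval Q z * F z) ` poly_on \<Omega> ` K = poly_on \<Omega> ` (*) Q ` K"
    by (simp add: image_image poly_on_mult)
  finally show ?thesis
    using assms by (auto simp: poly_closure_def poly_on_mult)
qed

sublocale ideal_closure poly_closure
proof
  show extensive: "K \<subseteq> poly_closure K" for K
    using closure_of_subset[of "poly_on \<Omega> ` K" X] poly_on_in_topspace
    by (auto simp: poly_closure_def)
  show least: "poly_closure K \<subseteq> poly_closure K'" if "K \<subseteq> poly_closure K'" for K K'
  proof -
    have "X closure_of (poly_on \<Omega> ` K) \<subseteq> X closure_of (poly_on \<Omega> ` K')"
      using that by (intro closure_of_minimal) (auto simp: poly_closure_def)
    then show ?thesis by (auto simp: poly_closure_def)
  qed
  show "ideal (poly_closure K)" if K: "ideal K" for K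
    unfolding cring.subspace_def
  proof (intro conjI ballI allI)
    show "0 \<in> poly_closure K" using extensive cring.subspace_0[OF K] by blast
    show "P + Q \<in> poly_closure K" if "P \<in> poly_closure K" "Q \<in> poly_closure K" for P Q
      using cfun.subspace_add[OF tvs.subspace_closure_of[OF subspace_image_poly_on[OF K]]] that
      by (simp add: poly_closure_def poly_on_add)
    show "Q * P \<in> poly_closure K" if "P \<in> poly_closure K" for Q P
    proof -
      have "(*) Q ` K \<subseteq> poly_closure K"
        using cring.subspace_scale[OF K] extensive by blast
      then show ?thesis using least mult_in_poly_closure[OF that] by blast
    qed
  qed
qed (rule mult_in_poly_closure)

lemma dense_iff_closure_eq_topspace:
  assumes K: "ideal K"
  shows "dense K \<longleftrightarrow> X closure_of (poly_on \<Omega> ` K) = topspace X"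
proof
  assume dense: "dense K"
  have "P \<in> poly_closure K" for P
    using cring.subspace_scale[OF closure_ideal[OF K], of 1 P] dense by (simp add: dense_def)
  then have "X closure_of (range (poly_on \<Omega>)) \<subseteq> X closure_of (poly_on \<Omega> ` K)"
    by (intro closure_of_minimal) (auto simp: poly_closure_def)
  then show "X closure_of (poly_on \<Omega> ` K) = topspace X"
    by (simp add: closure_range_poly_on closure_of_subset_topspace subset_antisym)
next
  assume "X closure_of (poly_on \<Omega> ` K) = topspace X"
  then show "dense K"
    using poly_on_in_topspace by (simp add: dense_def poly_closure_def)
qed

lemma invariant_closure_poly_on:
  "invariant_closure X (poly_on \<Omega> Q) = X closure_of (poly_on \<Omega> ` cring.span {Q})"
  unfolding cring.span_singleton by (simp add: invariant_closure_def image_image poly_on_mult)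

lemma cyclic_iff: "cyclic X (poly_on \<Omega> Q) \<longleftrightarrow> dense (ideal_gen {Q})"
  unfolding cyclic_def invariant_closure_poly_on ideal_gen_def
  by (rule dense_iff_closure_eq_topspace[OF cring.subspace_span, symmetric])

lemma joint_invariant_closure_poly_on:
  "joint_invariant_closure X (poly_on \<Omega> ` \<F>) = X closure_of (poly_on \<Omega> ` ideal_gen \<F>)"
  unfolding joint_invariant_closure_def
proof (intro equalityI)
  let ?N = "X closure_of (poly_on \<Omega> ` ideal_gen \<F>)"
  let ?S = "\<Union>F\<in>poly_on \<Omega> ` \<F>. invariant_closure X F"
  have "invariant_closure X (poly_on \<Omega> Q) \<subseteq> ?N" if "Q \<in> \<F>" for Q
    unfolding invariant_closure_poly_on ideal_gen_def
    using that by (intro closure_of_mono image_mono cring.span_mono) simp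
  then have "?S \<subseteq> ?N" by blast
  moreover have "cfun.subspace ?N"
    by (intro tvs.subspace_closure_of subspace_image_poly_on) (simp add: ideal_gen_def)
  ultimately have "cfun.span ?S \<subseteq> ?N"
    by (rule cfun.span_minimal)
  then show "X closure_of (cfun.span ?S) \<subseteq> ?N"
    by (rule closure_of_minimal) simp
  have "poly_on \<Omega> P \<in> cfun.span ?S" if "P \<in> cring.span \<F>" for P
    using that
  proof (induction rule: cring.span_induct_alt)
    case base
    show ?case unfolding poly_on_0 by (rule cfun.span_zero)
  next
    case (step c Q P)
    have "c * Q \<in> poly_closure (cring.span {Q})"
      by (intro subsetD[OF extensive] cring.span_scale cring.span_base) simp
    then have "poly_on \<Omega> (c * Q) \<in> ?S"
      using step(1) by (auto simp: poly_closure_def invariant_closure_poly_on)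
    then show ?case
      unfolding poly_on_add by (rule cfun.span_add[OF cfun.span_base step(2)])
  qed
  then show "?N \<subseteq> X closure_of (cfun.span ?S)"
    unfolding ideal_gen_def by (intro closure_of_mono image_subsetI)
qed

lemma jointly_cyclic_iff: "jointly_cyclic X (poly_on \<Omega> ` \<F>) \<longleftrightarrow> dense (ideal_gen \<F>)"
  unfolding jointly_cyclic_def joint_invariant_closure_poly_on ideal_gen_def
  by (rule dense_iff_closure_eq_topspace[OF cring.subspace_span, symmetric])

lemma poly_on_diff_eval_in_closure:
  "poly_on \<Omega> (P - cpoly_const (cpoly_eval P w)) \<in> X closure_of (poly_on \<Omega> ` point_ideal w)"
proof -
  have "P - cpoly_const (cpoly_eval P w) \<in> point_ideal w"
    by (simp add: point_ideal_def)
  then show ?thesis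
    using extensive[of "point_ideal w"] by (auto simp: poly_closure_def)
qed

lemma in_max_domain_of_point_ideal_not_dense:
  assumes not_dense: "\<not> dense (point_ideal w)"
  shows "w \<in> max_domain \<Omega> X"
proof -
  let ?N = "X closure_of (poly_on \<Omega> ` point_ideal w)"
  have N: "closedin X ?N" "cfun.subspace ?N"
    by (simp_all add: tvs.subspace_closure_of subspace_image_poly_on ideal_point_ideal)
  let ?S = "cfun.span (insert (poly_on \<Omega> 1) ?N)"
  have closed: "closedin X ?S"
    by (intro tvs.closedin_span_insert N poly_on_in_topspace)
  have "poly_on \<Omega> P \<in> ?S" for P
    unfolding poly_on_eq_diff_const_plus[of \<Omega> P "cpoly_eval P w"]
    by (intro cfun.span_add cfun.span_scale cfun.span_base insertI1 insertI2
        poly_on_diff_eval_in_closure)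
  then have "topspace X \<subseteq> ?S"
    unfolding closure_range_poly_on[symmetric]
    by (intro closure_of_minimal image_subsetI closed)
  then have span: "?S = topspace X"
    using closedin_subset[OF closed] by (rule equalityI[rotated])
  have "poly_on \<Omega> 1 \<notin> ?N"
    using not_dense by (simp add: dense_def poly_closure_def)
  from tvs.ex_continuous_linear_functional[OF N this span]
  obtain \<phi> where \<phi>: "Vector_Spaces.linear (\<lambda>c F z. c * F z) (*) \<phi>"
      "continuous_map X euclidean \<phi>" "\<forall>F\<in>?N. \<phi> F = 0" "\<phi> (poly_on \<Omega> 1) = 1"
    by (elim exE conjE)
  interpret \<phi>: Vector_Spaces.linear "\<lambda>c F z. c * F z" "(*)" \<phi> by (rule \<phi>(1))
  have "\<phi> (poly_on \<Omega> P) = cpoly_eval P w" for P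
    unfolding poly_on_eq_diff_const_plus[of \<Omega> P "cpoly_eval P w"]
    by (simp add: \<phi>.add \<phi>.scale \<phi>(3,4) poly_on_diff_eval_in_closure)
  moreover have "continuous_linear_functional X \<phi>"
    using \<phi>(2) by (simp add: continuous_linear_functional_def \<phi>.add \<phi>.scale)
  ultimately show ?thesis
    unfolding max_domain_def by blast
qed

lemma zero_set_disjoint_max_domain:
  assumes "dense J"
  shows "zero_set J \<inter> max_domain \<Omega> X = {}"
proof (rule ccontr)
  assume "\<not> ?thesis"
  then obtain w \<phi> where w: "w \<in> zero_set J" and \<phi>: "continuous_map X euclidean \<phi>"
      "\<And>P. \<phi> (poly_on \<Omega> P) = cpoly_eval P w"
    by (auto simp: max_domain_def continuous_linear_functional_def)
  have "poly_on \<Omega> ` J \<subseteq> {F \<in> topspace X. \<phi> F \<in> {0}}"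
    using poly_on_in_topspace \<phi>(2) w by (auto simp: zero_set_def)
  then have "X closure_of (poly_on \<Omega> ` J) \<subseteq> {F \<in> topspace X. \<phi> F \<in> {0}}"
    by (rule closure_of_minimal) (rule closedin_continuous_map_preimage[OF \<phi>(1)], simp)
  then have "\<phi> (poly_on \<Omega> 1) = 0"
    using assms by (auto simp: dense_def poly_closure_def)
  then show False using \<phi>(2)[of 1] by simp
qed

lemma dense_iff_zero_set_disjoint_max_domain:
  assumes J: "ideal J" and "finite (zero_set J)"
  shows "dense J \<longleftrightarrow> zero_set J \<inter> max_domain \<Omega> X = {}"
proof
  assume disjoint: "zero_set J \<inter> max_domain \<Omega> X = {}"
  show "dense J"
  proof (rule ccontr)
    assume "\<not> dense J"
    have "\<exists>w\<in>zero_set J. \<not> dense (point_ideal w)"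
    proof (rule ex_zero_not_dense[OF ideal_closure_axioms J \<open>\<not> dense J\<close>])
      fix K :: "'n cpoly set" and j
      assume K: "ideal K" "J \<subseteq> K" "\<not> dense K"
      obtain A where "(\<Prod>c\<in>#A. cpoly_var j - cpoly_const c) \<in> K"
        using ex_prod_linear_in_ideal_of_finite_zero_set[OF assms] K(2) by blast
      then show "\<exists>c. \<not> dense (cring.span (insert (cpoly_var j - cpoly_const c) K))"
        using ex_factor_not_dense[OF K(1,3)] by blast
    qed
    then show False
      using in_max_domain_of_point_ideal_not_dense disjoint by blast
  qed
qed (rule zero_set_disjoint_max_domain)

end

subsection \<open>Removing the greatest common divisor\<close>

lemma ideal_quotient_ideal: "ideal (quotient_ideal g \<F>)"
  unfolding cring.subspace_def quotient_ideal_def ideal_gen_def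
  by (auto simp: cring.span_zero cring.span_add distrib_left mult.left_commute
      intro: cring.span_scale)

lemma zero_set_eq_quotient_ideal_Un:
  assumes "\<And>P. P \<in> \<F> \<Longrightarrow> g dvd P"
  shows "zero_set \<F> = zero_set (quotient_ideal g \<F>) \<union> zero_set {g}"
proof
  show "zero_set \<F> \<subseteq> zero_set (quotient_ideal g \<F>) \<union> zero_set {g}"
  proof
    fix w assume "w \<in> zero_set \<F>"
    then have "w \<in> zero_set (ideal_gen \<F>)" by (simp only: zero_set_ideal_gen)
    then have "cpoly_eval g w * cpoly_eval Q w = 0" if "Q \<in> quotient_ideal g \<F>" for Q
      using that unfolding zero_set_def quotient_ideal_def by (simp flip: cpoly_eval_mult)
    then show "w \<in> zero_set (quotient_ideal g \<F>) \<union> zero_set {g}"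
      by (auto simp: zero_set_def)
  qed
  show "zero_set (quotient_ideal g \<F>) \<union> zero_set {g} \<subseteq> zero_set \<F>"
  proof
    fix w assume w: "w \<in> zero_set (quotient_ideal g \<F>) \<union> zero_set {g}"
    have "cpoly_eval P w = 0" if P: "P \<in> \<F>" for P
    proof -
      obtain Q where Q: "P = g * Q" using assms[OF P] by (elim dvdE)
      then have "Q \<in> quotient_ideal g \<F>"
        using P by (auto simp: quotient_ideal_def ideal_gen_def intro: cring.span_base)
      then show ?thesis using w Q by (auto simp: zero_set_def)
    qed
    then show "w \<in> zero_set \<F>" by (simp add: zero_set_def)
  qed
qed

lemma dense_ideal_gen_iff:
  assumes "ideal_closure C" and dvd: "\<And>P. P \<in> \<F> \<Longrightarrow> g dvd P"
  shows "ideal_closure.dense C (ideal_gen \<F>) \<longleftrightarrow>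
    ideal_closure.dense C (quotient_ideal g \<F>) \<and> ideal_closure.dense C (ideal_gen {g})"
proof -
  interpret ideal_closure C by fact
  show ?thesis
  proof (intro iffI conjI)
    assume dense: "dense (ideal_gen \<F>)"
    have "ideal_gen \<F> \<subseteq> quotient_ideal g \<F>"
      by (auto simp: quotient_ideal_def ideal_gen_def intro: cring.span_scale)
    then show "dense (quotient_ideal g \<F>)" using dense by (rule dense_mono)
    have "\<F> \<subseteq> ideal_gen {g}"
      using dvd by (auto simp: ideal_gen_def cring.span_singleton dvd_def mult.commute)
    then have "ideal_gen \<F> \<subseteq> ideal_gen {g}"
      unfolding ideal_gen_def by (rule cring.span_minimal) simp
    then show "dense (ideal_gen {g})" using dense by (rule dense_mono)
  next
    assume factors_dense: "dense (quotient_ideal g \<F>) \<and> dense (ideal_gen {g})"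
    show "dense (ideal_gen \<F>)"
    proof (rule dense_of_multiple[where K = "{}" and a = g and J = "quotient_ideal g \<F>"])
      show "(*) g ` quotient_ideal g \<F> \<subseteq> ideal_gen \<F>" by (auto simp: quotient_ideal_def)
      show "dense (quotient_ideal g \<F>)" "dense (cring.span {g})"
        using factors_dense by (simp_all add: ideal_gen_def)
    qed (simp_all add: ideal_gen_def)
  qed
qed

theorem theorem3p7:
  fixes \<Omega> :: "(complex ^ 'n::finite) set"
    and X :: "'n cfun topology"
    and \<F> :: "'n cpoly set"
    and g :: "'n cpoly"
  assumes "open \<Omega>" and "\<Omega> \<noteq> {}"
    and "hausdorff_tvs_in_Hol \<Omega> X"
    and "P1 \<Omega> X" and "P2 \<Omega> X" and "P3 X"
    and "is_gcd_of g \<F>"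
    and "finite (zero_set (quotient_ideal g \<F>))"
  shows "jointly_cyclic X (poly_on \<Omega> ` \<F>) \<longleftrightarrow>
           zero_set \<F> \<inter> max_domain \<Omega> X = {} \<and> cyclic X (poly_on \<Omega> g)"
proof -
  interpret poly_space \<Omega> X using assms by unfold_locales
  let ?J = "quotient_ideal g \<F>" and ?M = "max_domain \<Omega> X"
  have dvd: "g dvd P" if "P \<in> \<F>" for P
    using that assms(7) by (simp add: is_gcd_of_def)
  have "jointly_cyclic X (poly_on \<Omega> ` \<F>) \<longleftrightarrow> dense ?J \<and> dense (ideal_gen {g})"
    unfolding jointly_cyclic_iff by (rule dense_ideal_gen_iff[OF ideal_closure_axioms dvd])
  also have "\<dots> \<longleftrightarrow> zero_set ?J \<inter> ?M = {} \<and> dense (ideal_gen {g})"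
    using dense_iff_zero_set_disjoint_max_domain[OF ideal_quotient_ideal assms(8)] by (simp only:)
  also have "\<dots> \<longleftrightarrow> zero_set \<F> \<inter> ?M = {} \<and> dense (ideal_gen {g})"
    using zero_set_disjoint_max_domain[of "ideal_gen {g}"] zero_set_eq_quotient_ideal_Un[OF dvd]
    by (auto simp only: zero_set_ideal_gen)
  finally show ?thesis unfolding cyclic_iff .
qed

end
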